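(* Let $G$ be a finite graph and let $\mathcal S$ be any separation system of $G$ that separates some set $\mathcal I$ of $\mathcal S$-inseparable sets of vertices well. Then $\mathcal S$ has a nested $\mathcal I$-relevant subsystem $\mathcal N(\mathcal S,\mathcal I)\subseteq\mathcal S$ (a subset of $\mathcal S$ that is itself a separation system) that weakly distinguishes all weakly $\mathcal S$-distinguishable sets in $\mathcal I$; that is, any two sets in $\mathcal I$ that are weakly distinguished by $\mathcal S$ are weakly distinguished by $\mathcal N(\mathcal S,\mathcal I)$.
   Context: A separation of $G=(V,E)$ is an ordered pair $(A,B)$ with $A,B\subseteq V$ and $G[A]\cup G[B]=G$; it is proper if $A\setminus B\neq\emptyset\neq B\setminus A$. Write $(A,B)\le(C,D)$ if $A\subseteq C$ and $B\supseteq D$. Two separations $(A,B),(C,D)$ are nested if $(A,B)$ is $\le$-comparable with $(C,D)$ or with $(D,C)$; otherwise they cross. A set of separations is nested if every two of its elements are nested. A separation system is a set of proper separations that contains $(B,A)$ whenever it contains $(A,B)$. $(A,B)$ separates a set $I\subseteq V$ if $I$ meets both $A\setminus B$ and $B\setminus A$. A set of vertices is $\mathcal S$-inseparable if no separation in $\mathcal S$ separates it. Two sets $I_0,I_1$ are weakly separated by $(A,B)$ if $I_i\subseteq A$ and $I_{1-i}\subseteq B$ for some $i\in\{0,1\}$. A set of separations weakly distinguishes $I_0$ from $I_1$ if it contains a separation that weakly separates them; $I_0,I_1$ are then called weakly $\mathcal S$-distinguishable when that set is $\mathcal S$. A separation is $\mathcal I$-relevant if it weakly separates some two sets in $\mathcal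 I$; a separation system is $\mathcal I$-relevant if all its elements are. Given a separation system $\mathcal S$ and a set $\mathcal I$ of $\mathcal S$-inseparable sets, $\mathcal S$ separates $\mathcal I$ well if for every pair of crossing separations $(A,B),(C,D)\in\mathcal S$ the following holds: for all $I_1,I_2\in\mathcal I$ with $I_1\subseteq A\cap C$ and $I_2\subseteq B\cap D$ there is an $(E,F)\in\mathcal S$ such that $I_1\subseteq E\subseteq A\cap C$ and $F\supseteq B\cup D$. *)

theory Defs
  imports "Graph_Theory.Digraph_Component"
begin

type_synonym 'a separation = "'a set \<times> 'a set"

(* Undirected simple finite graphs are the symmetric digraphs of the locale graph.
   union has to be qualified, since Set.union is a different constant. *)

fun is_separation :: "('a, 'b) pre_digraph \<Rightarrow> 'a separation \<Rightarrow> bool" where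
  "is_separation G (A, B) \<longleftrightarrow>
     A \<subseteq> verts G \<and> B \<subseteq> verts G \<and> Digraph_Component.union (G \<restriction> A) (G \<restriction> B) = G"

fun proper :: "'a separation \<Rightarrow> bool" where
  "proper (A, B) \<longleftrightarrow> A - B \<noteq> {} \<and> B - A \<noteq> {}"

(* Not the componentwise order on pairs: the second component is reversed. *)
fun sep_le :: "'a separation \<Rightarrow> 'a separation \<Rightarrow> bool" where
  "sep_le (A, B) (C, D) \<longleftrightarrow> A \<subseteq> C \<and> B \<supseteq> D"

definition sep_comparable :: "'a separation \<Rightarrow> 'a separation \<Rightarrow> bool" where
  "sep_comparable s t \<longleftrightarrow> sep_le s t \<or> sep_le t s"

fun nested :: "'a separation \<Rightarrow> 'a separation \<Rightarrow> bool" where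
  "nested (A, B) (C, D) \<longleftrightarrow>
     sep_comparable (A, B) (C, D) \<or> sep_comparable (A, B) (D, C)"

abbreviation crosses :: "'a separation \<Rightarrow> 'a separation \<Rightarrow> bool" where
  "crosses s t \<equiv> \<not> nested s t"

definition nested_set :: "'a separation set \<Rightarrow> bool" where
  "nested_set S \<longleftrightarrow> (\<forall>s\<in>S. \<forall>t\<in>S. nested s t)"

definition separation_system :: "('a, 'b) pre_digraph \<Rightarrow> 'a separation set \<Rightarrow> bool" where
  "separation_system G S \<longleftrightarrow>
     (\<forall>s\<in>S. is_separation G s \<and> proper s) \<and>
     (\<forall>A B. (A, B) \<in> S \<longrightarrow> (B, A) \<in> S)"

fun separates :: "'a separation \<Rightarrow> 'a set \<Rightarrow> bool" where
  "separates (A, B) I \<longleftrightarrow> I \<inter> (A - B) \<noteq> {} \<and> I \<inter> (B - A) \<noteq> {}"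

definition inseparable :: "('a, 'b) pre_digraph \<Rightarrow> 'a separation set \<Rightarrow> 'a set \<Rightarrow> bool" where
  "inseparable G S I \<longleftrightarrow> I \<subseteq> verts G \<and> (\<forall>s\<in>S. \<not> separates s I)"

fun weakly_separates :: "'a separation \<Rightarrow> 'a set \<Rightarrow> 'a set \<Rightarrow> bool" where
  "weakly_separates (A, B) I\<^sub>0 I\<^sub>1 \<longleftrightarrow>
     I\<^sub>0 \<subseteq> A \<and> I\<^sub>1 \<subseteq> B \<or> I\<^sub>1 \<subseteq> A \<and> I\<^sub>0 \<subseteq> B"

definition weakly_distinguishes :: "'a separation set \<Rightarrow> 'a set \<Rightarrow> 'a set \<Rightarrow> bool" where
  "weakly_distinguishes S I\<^sub>0 I\<^sub>1 \<longleftrightarrow> (\<exists>s\<in>S. weakly_separates s I\<^sub>0 I\<^sub>1)"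

(* "Some two sets" means two distinct sets; without this, every (A, B) such that A \<inter> B
   includes a member of \<I> would count as relevant. *)
definition relevant :: "'a set set \<Rightarrow> 'a separation \<Rightarrow> bool" where
  "relevant \<I> s \<longleftrightarrow> (\<exists>I\<^sub>0\<in>\<I>. \<exists>I\<^sub>1\<in>\<I>. I\<^sub>0 \<noteq> I\<^sub>1 \<and> weakly_separates s I\<^sub>0 I\<^sub>1)"

definition relevant_system :: "'a set set \<Rightarrow> 'a separation set \<Rightarrow> bool" where
  "relevant_system \<I> S \<longleftrightarrow> (\<forall>s\<in>S. relevant \<I> s)"

(* Here I\<^sub>1 and I\<^sub>2 need not be distinct. *)
definition separates_well :: "'a separation set \<Rightarrow> 'a set set \<Rightarrow> bool" where
  "separates_well S \<I> \<longleftrightarrow>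
     (\<forall>A B C D. (A, B) \<in> S \<longrightarrow> (C, D) \<in> S \<longrightarrow> crosses (A, B) (C, D) \<longrightarrow>
        (\<forall>I\<^sub>1\<in>\<I>. \<forall>I\<^sub>2\<in>\<I>. I\<^sub>1 \<subseteq> A \<inter> C \<longrightarrow> I\<^sub>2 \<subseteq> B \<inter> D \<longrightarrow>
           (\<exists>E F. (E, F) \<in> S \<and> I\<^sub>1 \<subseteq> E \<and> E \<subseteq> A \<inter> C \<and> F \<supseteq> B \<union> D)))"

end

theory Submission
  imports Defs
begin

text \<open>
  The nested subsystem is peeled off from the outside, one separation at a time.  Among the
  relevant separations in \<open>S\<close> pick a \<open>\<le>\<close>-minimal one, \<open>(A, B)\<close>.

  It is nested with every relevant \<open>(C, D) \<in> S\<close>.  If it crossed \<open>(C, D)\<close>, then two different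
  members of \<open>\<I>\<close> would lie in opposite corners, one in a corner inside \<open>A\<close> and the other in the
  opposite corner inside \<open>B\<close>.  Since \<open>S\<close> separates \<open>\<I>\<close> well, there would be a
  relevant separation below both \<open>(A, B)\<close> and \<open>(C, D)\<close> or \<open>(D, C)\<close>, which minimality forbids
  (lemma \<open>minimal_relevant_nested\<close>).

  Consequently \<open>(A, B)\<close> weakly separates every pair that involves a set \<open>I \<subseteq> A\<close> and is weakly
  distinguished by \<open>S\<close>: the second set either lies in \<open>B\<close>, or it lies in \<open>A\<close> too, and then a
  separation of \<open>S\<close> that tells the two apart has \<open>A\<close> inside one of its sides and its other side
  inside \<open>B\<close>, so that \<open>B\<close> includes one of the two
  (lemma \<open>minimal_relevant_distinguishes\<close>).  Hence \<open>(A, B)\<close> and \<open>(B, A)\<close> go into the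
  subsystem, the members of \<open>\<I>\<close> inside \<open>A\<close> are discarded, and the argument is repeated with the
  remaining ones.  At least one member is discarded each time, so this stops.
\<close>

text \<open>
  Here only the corner sets \<open>I\<^sub>1 \<noteq> I\<^sub>2\<close> count.  The recursion needs this weaker form because it
  passes to the relevant part of \<open>S\<close>: the separation \<open>(E, F)\<close> found for distinct sets is itself
  relevant, whereas one found for \<open>I\<^sub>1 = I\<^sub>2\<close> may be lost.
\<close>

definition separates_distinct_well :: "'a separation set \<Rightarrow> 'a set set \<Rightarrow> bool" where
  "separates_distinct_well S \<I> \<longleftrightarrow>
     (\<forall>A B C D. (A, B) \<in> S \<longrightarrow> (C, D) \<in> S \<longrightarrow> crosses (A, B) (C, D) \<longrightarrow>
        (\<forall>I\<^sub>1\<in>\<I>. \<forall>I\<^sub>2\<in>\<I>. I\<^sub>1 \<noteq> I\<^sub>2 \<longrightarrow> I\<^sub>1 \<subseteq> A \<inter> C \<longrightarrow> I\<^sub>2 \<subseteq> B \<inter> D \<longrightarrow>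
           (\<exists>E F. (E, F) \<in> S \<and> I\<^sub>1 \<subseteq> E \<and> E \<subseteq> A \<inter> C \<and> F \<supseteq> B \<union> D)))"

lemma sep_le_trans: "sep_le r s \<Longrightarrow> sep_le s t \<Longrightarrow> sep_le r t"
  by (cases r; cases s; cases t) auto

lemma sep_le_antisym: "sep_le s t \<Longrightarrow> sep_le t s \<Longrightarrow> s = t"
  by (cases s; cases t) auto

lemma nested_sym: "nested s t \<Longrightarrow> nested t s"
  by (cases s; cases t) (auto simp: sep_comparable_def)

lemma nested_inverse: "nested (A, B) t \<Longrightarrow> nested (B, A) t"
  by (cases t) (auto simp: sep_comparable_def)

lemma relevant_inverse: "relevant \<I> (A, B) \<Longrightarrow> relevant \<I> (B, A)"
  unfolding relevant_def by auto

lemma weakly_separates_commute: "weakly_separates s I J \<longleftrightarrow> weakly_separates s J I"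
  by (cases s) auto

lemma relevantI:
  "I \<in> \<I> \<Longrightarrow> J \<in> \<I> \<Longrightarrow> I \<noteq> J \<Longrightarrow> I \<subseteq> A \<Longrightarrow> J \<subseteq> B \<Longrightarrow> relevant \<I> (A, B)"
  unfolding relevant_def weakly_separates.simps by blast

lemma separates_distinct_wellE:
  assumes "separates_distinct_well S \<I>" "(A, B) \<in> S" "(C, D) \<in> S" "crosses (A, B) (C, D)"
    and "I \<in> \<I>" "J \<in> \<I>" "I \<noteq> J" "I \<subseteq> A \<inter> C" "J \<subseteq> B \<inter> D"
  obtains E F where "(E, F) \<in> S" "relevant \<I> (E, F)" "I \<subseteq> E" "E \<subseteq> A \<inter> C" "B \<union> D \<subseteq> F"
proof -
  from assms obtain E F where EF: "(E, F) \<in> S" "I \<subseteq> E" "E \<subseteq> A \<inter> C" "B \<union> D \<subseteq> F"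
    unfolding separates_distinct_well_def by metis
  have "J \<subseteq> F"
    using assms(9) EF(4) by blast
  then have "relevant \<I> (E, F)"
    by (rule relevantI[OF assms(5-7) EF(2)])
  with EF that show ?thesis
    by blast
qed

lemma separates_distinct_well_subset:
  assumes "separates_distinct_well S \<I>" "\<J> \<subseteq> \<I>"
  shows "separates_distinct_well S \<J>"
  unfolding separates_distinct_well_def
proof (intro allI ballI impI)
  fix A B C D I J
  assume *: "(A, B) \<in> S" "(C, D) \<in> S" "crosses (A, B) (C, D)"
    and IJ: "I \<in> \<J>" "J \<in> \<J>" "I \<noteq> J" "I \<subseteq> A \<inter> C" "J \<subseteq> B \<inter> D"
  have "I \<in> \<I>" "J \<in> \<I>"
    using IJ(1,2) assms(2) by auto
  then show "\<exists>E F. (E, F) \<in> S \<and> I \<subseteq> E \<and> E \<subseteq> A \<inter> C \<and> F \<supseteq> B \<union> D"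
    by (rule separates_distinct_wellE[OF assms(1) * _ _ IJ(3-5)]) blast
qed

lemma exists_minimal_separation:
  assumes "finite S" "S \<noteq> {}"
  obtains m where "m \<in> S" "\<And>s. s \<in> S \<Longrightarrow> sep_le s m \<Longrightarrow> s = m"
proof -
  have "asymp_on S (\<lambda>s t. sep_le s t \<and> s \<noteq> t)"
    by (rule asymp_onI) (meson sep_le_antisym)
  moreover have "transp_on S (\<lambda>s t. sep_le s t \<and> s \<noteq> t)"
    by (rule transp_onI) (metis sep_le_antisym sep_le_trans)
  ultimately have "\<exists>m\<in>S. \<forall>s\<in>S. s \<noteq> m \<longrightarrow> \<not> (sep_le s m \<and> s \<noteq> m)"
    using assms Finite_Set.bex_min_element by blast
  then show ?thesis
    using that by blast
qed

lemma inseparable_cases: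
  assumes "is_separation G (A, B)" "(A, B) \<in> S" "inseparable G S I"
  shows "I \<subseteq> A \<or> I \<subseteq> B"
proof -
  from assms(1) have "verts (Digraph_Component.union (G \<restriction> A) (G \<restriction> B)) = verts G"
    by simp
  then have "A \<union> B = verts G"
    by simp
  with assms(2,3) show ?thesis
    unfolding inseparable_def by fastforce
qed

text \<open>
  Take \<open>I\<^sub>1 \<subseteq> A\<close> and \<open>I\<^sub>2 \<subseteq> B\<close> that witness the relevance of the minimal \<open>(A, B)\<close>.  If \<open>(C, D)\<close>
  has \<open>I\<^sub>1\<close> and \<open>I\<^sub>2\<close> on different sides, they themselves lie in opposite corners.  Otherwise both
  lie on one side, say \<open>C\<close>; relevance of \<open>(C, D)\<close> provides a set inside \<open>D\<close>, and this set
  faces \<open>I\<^sub>2\<close> or \<open>I\<^sub>1\<close> across a corner, according to whether it lies in \<open>A\<close> or in \<open>B\<close>.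
\<close>

lemma minimal_relevant_nested:
  assumes sym: "\<And>C D. (C, D) \<in> S \<Longrightarrow> (D, C) \<in> S"
    and sides: "\<And>C D I. (C, D) \<in> S \<Longrightarrow> I \<in> \<I> \<Longrightarrow> I \<subseteq> C \<or> I \<subseteq> D"
    and well: "separates_distinct_well S \<I>"
    and AB: "(A, B) \<in> S" "relevant \<I> (A, B)"
    and minimal: "\<And>s. s \<in> S \<Longrightarrow> relevant \<I> s \<Longrightarrow> sep_le s (A, B) \<Longrightarrow> s = (A, B)"
    and CD: "(C, D) \<in> S" "relevant \<I> (C, D)"
  shows "nested (A, B) (C, D)"
proof -
  have corner: "nested (A, B) (X, Y)"
    if XY: "(X, Y) \<in> S" and I: "I \<in> \<I>" "J \<in> \<I>" "I \<noteq> J" "I \<subseteq> A \<inter> X" "J \<subseteq> B \<inter> Y"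
    for X Y I J
  proof (rule ccontr)
    assume cross: "crosses (A, B) (X, Y)"
    obtain E F where EF: "(E, F) \<in> S" "relevant \<I> (E, F)" "E \<subseteq> A \<inter> X" "B \<union> Y \<subseteq> F"
      using separates_distinct_wellE[OF well AB(1) XY cross I] .
    then have "sep_le (E, F) (A, B)"
      by simp
    with EF(1,2) have "(E, F) = (A, B)"
      by (rule minimal)
    then have "sep_le (A, B) (X, Y)"
      using EF(3,4) by simp
    then show False
      using cross by (simp add: sep_comparable_def)
  qed
  have swap: "nested (A, B) (C, D)" if "nested (A, B) (D, C)"
    using that by (simp add: sep_comparable_def disj_commute)
  obtain I\<^sub>1 I\<^sub>2 where I: "I\<^sub>1 \<in> \<I>" "I\<^sub>2 \<in> \<I>" "I\<^sub>1 \<noteq> I\<^sub>2" "I\<^sub>1 \<subseteq> A" "I\<^sub>2 \<subseteq> B"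
    using AB(2) unfolding relevant_def weakly_separates.simps by metis
  obtain J\<^sub>1 J\<^sub>2 where J: "J\<^sub>1 \<in> \<I>" "J\<^sub>2 \<in> \<I>" "J\<^sub>1 \<subseteq> C" "J\<^sub>2 \<subseteq> D"
    using CD(2) unfolding relevant_def weakly_separates.simps by metis
  have same_side: "nested (A, B) (X, Y)"
    if XY: "(X, Y) \<in> S" and both: "I\<^sub>1 \<subseteq> X" "I\<^sub>2 \<subseteq> X" "\<not> I\<^sub>1 \<subseteq> Y" "\<not> I\<^sub>2 \<subseteq> Y"
      and J: "J \<in> \<I>" "J \<subseteq> Y" for X Y J
  proof (cases "J \<subseteq> A")
    case True
    have "nested (A, B) (Y, X)"
      by (rule corner[of _ _ J I\<^sub>2]) (use True both J I sym[OF XY] in blast)+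
    then show ?thesis
      by (simp add: sep_comparable_def disj_commute)
  next
    case False
    then have "J \<subseteq> B"
      using sides[OF AB(1) J(1)] by blast
    then show ?thesis
      by (intro corner[of _ _ I\<^sub>1 J]) (use XY both J I in blast)+
  qed
  consider "I\<^sub>1 \<subseteq> C" "I\<^sub>2 \<subseteq> D" | "I\<^sub>1 \<subseteq> D" "I\<^sub>2 \<subseteq> C"
    | "I\<^sub>1 \<subseteq> C" "I\<^sub>2 \<subseteq> C" "\<not> I\<^sub>1 \<subseteq> D" "\<not> I\<^sub>2 \<subseteq> D"
    | "I\<^sub>1 \<subseteq> D" "I\<^sub>2 \<subseteq> D" "\<not> I\<^sub>1 \<subseteq> C" "\<not> I\<^sub>2 \<subseteq> C"
    using sides[OF CD(1) I(1)] sides[OF CD(1) I(2)] by blast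
  then show ?thesis
  proof cases
    case 1
    then show ?thesis
      using corner[OF CD(1) I(1-3)] I by blast
  next
    case 2
    then show ?thesis
      using corner[OF sym[OF CD(1)] I(1-3)] I swap by blast
  next
    case 3
    then show ?thesis
      using same_side[OF CD(1)] J by blast
  next
    case 4
    then show ?thesis
      using same_side[OF sym[OF CD(1)]] J swap by blast
  qed
qed

text \<open>
  Of the four ways of being nested with \<open>(A, B)\<close>, minimality leaves only that one side of \<open>(C, D)\<close>
  includes \<open>A\<close> and the other lies in \<open>B\<close>.  The one of \<open>I\<close>, \<open>J\<close> in the latter side is therefore in
  \<open>B\<close>; if it is \<open>I\<close>, then \<open>I \<subseteq> A \<inter> B\<close> and it does not matter on which side of \<open>(A, B)\<close> the set
  \<open>J\<close> lies.
\<close>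

lemma minimal_relevant_distinguishes:
  assumes sym: "\<And>C D. (C, D) \<in> S \<Longrightarrow> (D, C) \<in> S"
    and sides: "\<And>C D I. (C, D) \<in> S \<Longrightarrow> I \<in> \<I> \<Longrightarrow> I \<subseteq> C \<or> I \<subseteq> D"
    and well: "separates_distinct_well S \<I>"
    and AB: "(A, B) \<in> S" "relevant \<I> (A, B)"
    and minimal: "\<And>s. s \<in> S \<Longrightarrow> relevant \<I> s \<Longrightarrow> sep_le s (A, B) \<Longrightarrow> s = (A, B)"
    and IJ: "I \<in> \<I>" "J \<in> \<I>" "I \<noteq> J" "I \<subseteq> A"
    and dist: "weakly_distinguishes S I J"
  shows "weakly_separates (A, B) I J"
proof -
  obtain C D where CD: "(C, D) \<in> S" "weakly_separates (C, D) I J"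
    using dist unfolding weakly_distinguishes_def by (metis surj_pair)
  have rel: "relevant \<I> (C, D)"
    using CD(2) IJ unfolding relevant_def by blast
  have "nested (A, B) (C, D)"
    using sym sides well AB minimal CD(1) rel by (rule minimal_relevant_nested)
  moreover have "(C, D) = (A, B)" if "sep_le (C, D) (A, B)"
    using minimal CD(1) rel that by blast
  moreover have "(D, C) = (A, B)" if "sep_le (D, C) (A, B)"
    using minimal sym[OF CD(1)] relevant_inverse[OF rel] that by blast
  ultimately have "A \<subseteq> C \<and> D \<subseteq> B \<or> A \<subseteq> D \<and> C \<subseteq> B"
    unfolding nested.simps sep_comparable_def sep_le.simps prod.inject by blast
  then have "I \<subseteq> B \<or> J \<subseteq> B"
    using CD(2) by auto
  then show ?thesis
    using sides[OF AB(1) IJ(2)] IJ(4) by auto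
qed

text \<open>
  The recursive call is made with the relevant part of \<open>S\<close>, not with \<open>S\<close>: only with relevant
  separations is the chosen minimal one known to be nested.
\<close>

lemma nested_relevant_subsystem:
  assumes "finite \<I>" "finite S"
    and "\<And>C D. (C, D) \<in> S \<Longrightarrow> (D, C) \<in> S"
    and "\<And>C D I. (C, D) \<in> S \<Longrightarrow> I \<in> \<I> \<Longrightarrow> I \<subseteq> C \<or> I \<subseteq> D"
    and "separates_distinct_well S \<I>"
  shows "\<exists>N\<subseteq>S. (\<forall>A B. (A, B) \<in> N \<longrightarrow> (B, A) \<in> N) \<and> nested_set N \<and> relevant_system \<I> N \<and>
           (\<forall>I\<in>\<I>. \<forall>J\<in>\<I>. I \<noteq> J \<longrightarrow> weakly_distinguishes S I J \<longrightarrow> weakly_distinguishes N I J)"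
  using assms
proof (induction \<I> arbitrary: S rule: finite_psubset_induct)
  case (psubset \<I>)
  note sym = psubset.prems(2) and sides = psubset.prems(3) and well = psubset.prems(4)
  define R where "R = {s \<in> S. relevant \<I> s}"
  have R_sub: "R \<subseteq> S"
    unfolding R_def by blast
  have R_sym: "(D, C) \<in> R" if "(C, D) \<in> R" for C D
    using that sym relevant_inverse unfolding R_def by blast
  have into_R: "weakly_distinguishes R I J"
    if "weakly_distinguishes S I J" "I \<in> \<I>" "J \<in> \<I>" "I \<noteq> J" for I J
    using that unfolding R_def weakly_distinguishes_def relevant_def by blast
  have R_well: "separates_distinct_well R \<I>"
    unfolding separates_distinct_well_def
  proof (intro allI ballI impI)
    fix A B C D I J
    assume *: "(A, B) \<in> R" "(C, D) \<in> R" "crosses (A, B) (C, D)"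
      "I \<in> \<I>" "J \<in> \<I>" "I \<noteq> J" "I \<subseteq> A \<inter> C" "J \<subseteq> B \<inter> D"
    from * R_sub have "(A, B) \<in> S" "(C, D) \<in> S"
      by blast+
    from separates_distinct_wellE[OF well this *(3-8)] obtain E F where
      EF: "(E, F) \<in> S" "relevant \<I> (E, F)" "I \<subseteq> E" "E \<subseteq> A \<inter> C" "B \<union> D \<subseteq> F" .
    then show "\<exists>E F. (E, F) \<in> R \<and> I \<subseteq> E \<and> E \<subseteq> A \<inter> C \<and> F \<supseteq> B \<union> D"
      using EF unfolding R_def by blast
  qed
  show ?case
  proof (cases "R = {}")
    case True
    then have "\<not> weakly_distinguishes S I J" if "I \<in> \<I>" "J \<in> \<I>" "I \<noteq> J" for I J
      using into_R[OF _ that] unfolding weakly_distinguishes_def by blast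
    then show ?thesis
      by (intro exI[of _ "{}"]) (auto simp: nested_set_def relevant_system_def)
  next
    case False
    have "finite R"
      using R_sub psubset.prems(1) by (rule finite_subset)
    then obtain A B where AB_R: "(A, B) \<in> R"
      and min_R: "\<And>s. s \<in> R \<Longrightarrow> sep_le s (A, B) \<Longrightarrow> s = (A, B)"
      using exists_minimal_separation[OF _ False] by (metis surj_pair)
    have AB: "(A, B) \<in> S" "relevant \<I> (A, B)"
      using AB_R unfolding R_def by auto
    have minimal: "s = (A, B)" if "s \<in> S" "relevant \<I> s" "sep_le s (A, B)" for s
      using min_R that unfolding R_def by blast
    have AB_nested: "nested (A, B) s" if "s \<in> R" for s
      using minimal_relevant_nested[OF sym sides well AB minimal] that
      unfolding R_def by (cases s) auto
    have AB_dist: "weakly_separates (A, B) I J"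
      if "I \<in> \<I>" "J \<in> \<I>" "I \<noteq> J" "I \<subseteq> A" "weakly_distinguishes S I J" for I J
      using minimal_relevant_distinguishes[OF sym sides well AB minimal that] .
    define \<J> where "\<J> = {I \<in> \<I>. \<not> I \<subseteq> A}"
    have "\<J> \<subset> \<I>"
      using AB(2) unfolding \<J>_def relevant_def by auto
    have \<J>_sides: "I \<subseteq> C \<or> I \<subseteq> D" if "(C, D) \<in> R" "I \<in> \<J>" for C D I
      using that sides R_sub unfolding \<J>_def by blast
    have "separates_distinct_well R \<J>"
      by (rule separates_distinct_well_subset[OF R_well]) (use \<open>\<J> \<subset> \<I>\<close> in blast)
    from psubset.IH[OF \<open>\<J> \<subset> \<I>\<close> \<open>finite R\<close> R_sym \<J>_sides this]
    obtain N where N: "N \<subseteq> R" "\<forall>C D. (C, D) \<in> N \<longrightarrow> (D, C) \<in> N" "nested_set N"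
      "\<forall>I\<in>\<J>. \<forall>J\<in>\<J>. I \<noteq> J \<longrightarrow> weakly_distinguishes R I J \<longrightarrow> weakly_distinguishes N I J"
      by blast
    define M where "M = N \<union> {(A, B), (B, A)}"
    have "M \<subseteq> R"
      using N(1) AB_R R_sym unfolding M_def by blast
    have M_sym: "\<forall>C D. (C, D) \<in> M \<longrightarrow> (D, C) \<in> M"
      using N(2) unfolding M_def by blast
    have "nested_set M"
      unfolding nested_set_def
    proof (intro ballI)
      fix s t
      assume st: "s \<in> M" "t \<in> M"
      then have "s \<in> R" "t \<in> R"
        using \<open>M \<subseteq> R\<close> by auto
      then have "nested (A, B) s" "nested (B, A) s" "nested (A, B) t" "nested (B, A) t"
        using AB_nested nested_inverse by blast+
      then show "nested s t"
        using st N(3) nested_sym unfolding M_def nested_set_def by blast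
    qed
    moreover have "relevant_system \<I> M"
      using \<open>M \<subseteq> R\<close> unfolding R_def relevant_system_def by blast
    moreover have "weakly_distinguishes M I J"
      if IJ: "I \<in> \<I>" "J \<in> \<I>" "I \<noteq> J" and d: "weakly_distinguishes S I J" for I J
    proof -
      have d': "weakly_distinguishes S J I"
        using d weakly_separates_commute unfolding weakly_distinguishes_def by blast
      consider "I \<subseteq> A" | "J \<subseteq> A" | "I \<in> \<J>" "J \<in> \<J>"
        using IJ unfolding \<J>_def by blast
      then show ?thesis
      proof cases
        case 1
        then show ?thesis
          using AB_dist[OF IJ _ d] unfolding M_def weakly_distinguishes_def by blast
      next
        case 2
        then have "weakly_separates (A, B) I J"
          using AB_dist[OF IJ(2,1) _ _ d'] IJ(3) by auto
        then show ?thesis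
          unfolding M_def weakly_distinguishes_def by blast
      next
        case 3
        then have "weakly_distinguishes N I J"
          using N(4) into_R[OF d IJ] IJ(3) by blast
        then show ?thesis
          unfolding M_def weakly_distinguishes_def by blast
      qed
    qed
    ultimately show ?thesis
      using \<open>M \<subseteq> R\<close> R_sub M_sym by (intro exI[of _ M]) blast
  qed
qed

theorem theorem5p2:
  fixes G :: "('a, 'b) pre_digraph"
    and S :: "'a separation set"
    and \<I> :: "'a set set"
  assumes "graph G"
    and "separation_system G S"
    and "\<forall>I\<in>\<I>. inseparable G S I"
    and "separates_well S \<I>"
  shows "\<exists>N. N \<subseteq> S \<and> separation_system G N \<and> nested_set N \<and> relevant_system \<I> N \<and>
           (\<forall>I\<^sub>0\<in>\<I>. \<forall>I\<^sub>1\<in>\<I>. I\<^sub>0 \<noteq> I\<^sub>1 \<longrightarrow>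
              weakly_distinguishes S I\<^sub>0 I\<^sub>1 \<longrightarrow> weakly_distinguishes N I\<^sub>0 I\<^sub>1)"
proof -
  interpret graph G
    by (rule assms(1))
  have S_sep: "is_separation G s" if "s \<in> S" for s
    using assms(2) that unfolding separation_system_def by blast
  have "finite \<I>"
  proof (rule finite_subset)
    show "\<I> \<subseteq> Pow (verts G)"
      using assms(3) unfolding inseparable_def by blast
  qed simp
  moreover have "finite S"
  proof (rule finite_subset)
    show "S \<subseteq> Pow (verts G) \<times> Pow (verts G)"
      using S_sep by fastforce
  qed simp
  moreover have "(D, C) \<in> S" if "(C, D) \<in> S" for C D
    using assms(2) that unfolding separation_system_def by blast
  moreover have "I \<subseteq> C \<or> I \<subseteq> D" if "(C, D) \<in> S" "I \<in> \<I>" for C D I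
    using inseparable_cases[OF S_sep] that assms(3) by blast
  moreover have "separates_distinct_well S \<I>"
    using assms(4) unfolding separates_well_def separates_distinct_well_def by blast
  ultimately obtain N where N: "N \<subseteq> S" "\<forall>A B. (A, B) \<in> N \<longrightarrow> (B, A) \<in> N" "nested_set N"
    "relevant_system \<I> N"
    "\<forall>I\<in>\<I>. \<forall>J\<in>\<I>. I \<noteq> J \<longrightarrow> weakly_distinguishes S I J \<longrightarrow> weakly_distinguishes N I J"
    using nested_relevant_subsystem[of \<I> S] by blast
  then have "separation_system G N"
    using assms(2) unfolding separation_system_def by blast
  with N show ?thesis
    by blast
qed

end
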